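(* For $R\ge0$ let $$\psi(R)=2\Big(h(0)-h\big(8R^2\big)\Big)+4\Big(-h'(0)+2h'\big(2R^2\big)\Big)\big(4R^2\big)+4\Big(h''(0)-2h''\big(2R^2\big)\Big)\big(4R^4\big).$$ At infinity the upper bound $\psi$ grows quartically, with the constant determined by the second derivative of $h$ at zero. Specifically, $$\psi(R)\to 2h(0)-16h'(0)R^2+16h''(0)R^4\quad\text{as }R\to\infty,$$ that is, the difference of the two sides tends to $0$ as $R\to\infty$.
   Context: Here $h:[0,\infty)\to\mathbb{R}$ is twice continuously differentiable, with $h\ge0$ and $h''\ge0$ both monotone decreasing and $h'\le0$ monotone increasing. ($h$ is the function for which the base field $u$ on $\mathbb{R}^D\times\mathbb{R}^D$ has isotropic covariance $h(\|x-y\|_2^2)$. The field $f(x^{(1)},x^{(2)})=u(x^{(1)},x^{(2)})-u(x^{(2)},x^{(1)})$ is approximated by its second-order Taylor polynomial at a point $(z^*,z^* )$, and $\psi(R)$ is the expression for the upper bound on the approximation error in the far regime, $R$ being the range of the distances of the inputs $x^{(1)},x^{(2)}\in\mathbb{R}^D$ from $z^*$.)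
   Formalization: The formal statement additionally assumes h(x) → 0 as x → ∞; without it the claim fails (for h = 1, ψ = 0 while the stated asymptote is 2), and the claim holds exactly when this limit is 0. *)

theory Defs
  imports Complex_Main
begin

text \<open>
  The functions \<open>h'\<close> and \<open>h''\<close> are passed explicitly; they stand for the first and second
  derivative of \<open>h\<close> on \<open>[0,\<infinity>)\<close>, which are one-sided at \<open>0\<close>.
\<close>

definition far_bound ::
  "(real \<Rightarrow> real) \<Rightarrow> (real \<Rightarrow> real) \<Rightarrow> (real \<Rightarrow> real) \<Rightarrow> real \<Rightarrow> real"
  where
  "far_bound h h' h'' R =
     2 * (h 0 - h (8 * R^2))
     + 4 * (- h' 0 + 2 * h' (2 * R^2)) * (4 * R^2)
     + 4 * (h'' 0 - 2 * h'' (2 * R^2)) * (4 * R^4)"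

end

theory Submission
  imports Defs
begin

text \<open>
  With \<open>t = 2 * R^2\<close>, the difference between the bound and its limiting quartic is
  \<open>- 2 * h (4 * t) + 16 * (t * h' t) - 8 * (t^2 * h'' t)\<close>, so \<open>t * h' t\<close> and \<open>t^2 * h'' t\<close> have to
  vanish at infinity. Decay of \<open>h\<close> alone would not give this, because \<open>h\<close> could fall in
  ever rarer steep steps; convexity excludes it. For a nonnegative convex \<open>f\<close>, the drop
  \<open>f (x/2) - f x\<close> is at most \<open>f (x/2)\<close> and at least \<open>x/2\<close> times the slope \<open>- f' x\<close> at the right end,
  which is the smallest downward slope on the interval (\<open>neg_deriv_le_half_point\<close>).

  Both \<open>h\<close> and \<open>- h'\<close> are nonnegative and convex. The estimate for \<open>h\<close> gives
  \<open>- (t * h' t) \<le> 2 * h (t/2)\<close>, and the estimate for \<open>- h'\<close> followed by that for \<open>h\<close> gives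
  \<open>t^2 * h'' t \<le> 8 * h (t/4)\<close>; both right-hand sides tend to \<open>0\<close>.
\<close>

text \<open>
  The derivative at \<open>x\<close> bounds all derivatives on \<open>[x/2, x]\<close> from above, so the mean value theorem
  on this interval turns it into a bound on the drop of \<open>f\<close>. Starting at \<open>x/2\<close> rather than at \<open>0\<close>
  makes the bound small whenever \<open>f\<close> vanishes at infinity.
\<close>

lemma neg_deriv_le_half_point:
  fixes f f' :: "real \<Rightarrow> real"
  assumes deriv: "\<And>x. x \<ge> 0 \<Longrightarrow> (f has_real_derivative f' x) (at x within {0..})"
    and nonneg: "\<And>x. x \<ge> 0 \<Longrightarrow> f x \<ge> 0"
    and mono: "mono_on {0..} f'"
    and "x > 0"
  shows "- (x * f' x) \<le> 2 * f (x / 2)"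
proof -
  have "(f has_real_derivative f' y) (at y)" if "y > 0" for y
  proof -
    have "at y within {0..} = at y"
      using that by (intro at_within_nhd[of _ "{0<..}"]) auto
    then show ?thesis
      using deriv[of y] that by simp
  qed
  then obtain z where z: "x / 2 < z" "z < x" "f x - f (x / 2) = (x - x / 2) * f' z"
    using MVT2[of "x / 2" x f f'] \<open>x > 0\<close> by auto
  have "f' z \<le> f' x"
    using mono z \<open>x > 0\<close> by (auto intro: mono_onD)
  then have "x * f' z \<le> x * f' x"
    using \<open>x > 0\<close> by simp
  moreover have "f x \<ge> 0"
    using nonneg \<open>x > 0\<close> by simp
  ultimately show ?thesis
    using z(3) by (simp add: field_simps)
qed

theorem proposition39:
  fixes h h' h'' :: "real \<Rightarrow> real"
  assumes deriv1: "\<And>x. x \<ge> 0 \<Longrightarrow> (h has_real_derivative h' x) (at x within {0..})"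
    and deriv2: "\<And>x. x \<ge> 0 \<Longrightarrow> (h' has_real_derivative h'' x) (at x within {0..})"
    and cont: "continuous_on {0..} h''"
    and h_nonneg: "\<And>x. x \<ge> 0 \<Longrightarrow> h x \<ge> 0"
    and h_decreasing: "antimono_on {0..} h"
    and h'_nonpos: "\<And>x. x \<ge> 0 \<Longrightarrow> h' x \<le> 0"
    and h'_increasing: "mono_on {0..} h'"
    and h''_nonneg: "\<And>x. x \<ge> 0 \<Longrightarrow> h'' x \<ge> 0"
    and h''_decreasing: "antimono_on {0..} h''"
    and h_vanishes: "(h \<longlongrightarrow> 0) at_top"
  shows "((\<lambda>R. far_bound h h' h'' R - (2 * h 0 - 16 * h' 0 * R^2 + 16 * h'' 0 * R^4)) \<longlongrightarrow> 0) at_top"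
proof -
  have first: "- (t * h' t) \<le> 2 * h (t / 2)" if "t > 0" for t
    using neg_deriv_le_half_point[OF deriv1 h_nonneg h'_increasing that] .
  have second: "t^2 * h'' t \<le> 8 * h (t / 4)" if "t > 0" for t
  proof -
    have "- (t * - h'' t) \<le> 2 * - h' (t / 2)"
    proof (rule neg_deriv_le_half_point[OF _ _ _ that])
      show "((\<lambda>x. - h' x) has_real_derivative - h'' x) (at x within {0..})" if "x \<ge> 0" for x
        using deriv2[OF that] by (rule DERIV_minus)
      show "mono_on {0..} (\<lambda>x. - h'' x)"
        using h''_decreasing by (auto simp: monotone_on_def)
    qed (use h'_nonpos in simp)
    then have "t * (t * h'' t) \<le> t * (- 2 * h' (t / 2))"
      using that by (intro mult_left_mono) auto
    also have "\<dots> = 4 * - (t / 2 * h' (t / 2))"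
      by simp
    also have "\<dots> \<le> 4 * (2 * h (t / 2 / 2))"
      using that by (intro mult_left_mono first) auto
    also have "\<dots> = 8 * h (t / 4)"
      by simp
    finally show ?thesis
      by (simp add: power2_eq_square mult.assoc)
  qed
  have h_lim: "((\<lambda>t. h (c * t)) \<longlongrightarrow> 0) at_top" if "c > 0" for c
    using filterlim_compose[OF h_vanishes
        filterlim_tendsto_pos_mult_at_top[OF tendsto_const that filterlim_ident]] .
  have lim1: "((\<lambda>t. t * h' t) \<longlongrightarrow> 0) at_top"
  proof (rule tendsto_sandwich[where f = "\<lambda>t. - 2 * h (1 / 2 * t)" and h = "\<lambda>t. 0"])
    show "\<forall>\<^sub>F t in at_top. - 2 * h (1 / 2 * t) \<le> t * h' t"
      using eventually_gt_at_top[of 0]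
    proof eventually_elim
      case (elim t)
      then show ?case using first[of t] by simp
    qed
    show "\<forall>\<^sub>F t in at_top. t * h' t \<le> 0"
      using eventually_gt_at_top[of 0]
      by eventually_elim (simp add: h'_nonpos mult_nonneg_nonpos)
    show "((\<lambda>t. - 2 * h (1 / 2 * t)) \<longlongrightarrow> 0) at_top"
      using tendsto_mult_left[OF h_lim[of "1 / 2"], of "- 2"] by simp
  qed simp
  have lim2: "((\<lambda>t. t^2 * h'' t) \<longlongrightarrow> 0) at_top"
  proof (rule tendsto_sandwich[where f = "\<lambda>t. 0" and h = "\<lambda>t. 8 * h (1 / 4 * t)"])
    show "\<forall>\<^sub>F t in at_top. t^2 * h'' t \<le> 8 * h (1 / 4 * t)"
      using eventually_gt_at_top[of 0]
    proof eventually_elim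
      case (elim t)
      then show ?case using second[of t] by simp
    qed
    show "\<forall>\<^sub>F t in at_top. 0 \<le> t^2 * h'' t"
      using eventually_gt_at_top[of 0]
      by eventually_elim (simp add: h''_nonneg)
    show "((\<lambda>t. 8 * h (1 / 4 * t)) \<longlongrightarrow> 0) at_top"
      using tendsto_mult_left[OF h_lim[of "1 / 4"], of 8] by simp
  qed simp
  have "((\<lambda>t. - 2 * h (4 * t) + 16 * (t * h' t) - 8 * (t^2 * h'' t))
      \<longlongrightarrow> - 2 * 0 + 16 * 0 - 8 * 0) at_top"
    by (intro tendsto_diff tendsto_add tendsto_mult tendsto_const h_lim lim1 lim2) simp
  moreover have "filterlim (\<lambda>R::real. 2 * R^2) at_top at_top"
    by (intro filterlim_tendsto_pos_mult_at_top[OF tendsto_const]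
        filterlim_pow_at_top filterlim_ident) auto
  ultimately have "((\<lambda>R. - 2 * h (4 * (2 * R^2)) + 16 * (2 * R^2 * h' (2 * R^2))
      - 8 * ((2 * R^2)^2 * h'' (2 * R^2))) \<longlongrightarrow> - 2 * 0 + 16 * 0 - 8 * 0) at_top"
    by (rule filterlim_compose)
  moreover have "far_bound h h' h'' R - (2 * h 0 - 16 * h' 0 * R^2 + 16 * h'' 0 * R^4)
      = - 2 * h (4 * (2 * R^2)) + 16 * (2 * R^2 * h' (2 * R^2))
        - 8 * ((2 * R^2)^2 * h'' (2 * R^2))" for R
    by (simp add: far_bound_def algebra_simps)
  ultimately show ?thesis
    by simp
qed

end
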